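(* Fix $r\ge 2$ and let $F$ be an $r$-uniform forest. Then $$\mathrm{ex}_{\to}(n,\mathrm{ord}(F))=O(n^{r-1}),$$ where the implied constant may depend on $r$ and $F$ but not on $n$.
   Context: An $r$-graph is a finite hypergraph all of whose edges have size $r$; hypergraphs are identified with their edge sets. The shadow $\partial H$ of an $r$-graph $H$ is the collection of $(r-1)$-sets contained in some edge of $H$. $r$-uniform trees are defined inductively: a single edge is a tree, and given any tree $T$, a tree with one more edge is obtained by selecting $f\in\partial T$ and a vertex $x$ not in $T$, and adding the edge $f\cup\{x\}$. An $r$-uniform forest is a subgraph of an $r$-uniform tree. An ordered $r$-graph is an $r$-graph with a linear ordering of its vertex set. An ordered $r$-graph is interval $r$-partite if there are intervals (sets of consecutive vertices) $I_1<I_2<\dots<I_r$ in the vertex ordering such that every edge has exactly one vertex in each $I_j$ (where $A<B$ means that every element of $A$ precedes every element of $B$). For an $r$-partite $r$-graph $F$, $\mathrm{ord}(F)$ is the family of interval $r$-partite ordered $r$-graphs that are isomorphic to $F$ as unordered $r$-graphs. An ordered $r$-graph $H$ contains an ordered $r$-graph $F'$ if there is an order-preserving injection $V(F')\to V(H)$ mapping edges to edges. For a family $\mathcal G$ of ordered $r$-graphs, $\mathrm{ex}_{\to}(n,\mathcal G)$ is the maximum number of edges in an $n$-vertex ordered $r$-graph that contains no member of $\mathcal G$. *)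

theory Defs
  imports "HOL-Library.Landau_Symbols"
begin

text \<open>An unordered \<open>r\<close>-graph is given by its edge set \<open>H\<close>; its vertex set is \<open>\<Union>H\<close>.\<close>

definition shadow :: "nat \<Rightarrow> 'a set set \<Rightarrow> 'a set set" where
  "shadow r H = {f. card f = r - 1 \<and> (\<exists>e\<in>H. f \<subseteq> e)}"

inductive uniform_tree :: "nat \<Rightarrow> 'a set set \<Rightarrow> bool" for r :: nat where
  single: "finite e \<Longrightarrow> card e = r \<Longrightarrow> uniform_tree r {e}"
| extend: "uniform_tree r T \<Longrightarrow> f \<in> shadow r T \<Longrightarrow> x \<notin> \<Union>T \<Longrightarrow>
    uniform_tree r (insert (f \<union> {x}) T)"

definition uniform_forest :: "nat \<Rightarrow> 'a set set \<Rightarrow> bool" where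
  "uniform_forest r F \<longleftrightarrow> (\<exists>T. uniform_tree r T \<and> F \<subseteq> T)"

text \<open>
  An ordered \<open>r\<close>-graph is a pair of a finite vertex set and an edge set, the vertices being
  ordered by the order of the ambient type. The vertex set is explicit, since a host graph on
  \<open>n\<close> vertices may have isolated vertices.
\<close>

type_synonym 'v ohgraph = "'v set \<times> 'v set set"

definition verts :: "'v ohgraph \<Rightarrow> 'v set" where "verts G = fst G"
definition edges :: "'v ohgraph \<Rightarrow> 'v set set" where "edges G = snd G"

definition ordered_rgraph :: "nat \<Rightarrow> 'v::linorder ohgraph \<Rightarrow> bool" where
  "ordered_rgraph r G \<longleftrightarrow>
     finite (verts G) \<and> (\<forall>e\<in>edges G. e \<subseteq> verts G \<and> card e = r)"

definition interval_of :: "'v::linorder set \<Rightarrow> 'v set \<Rightarrow> bool" where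
  "interval_of V I \<longleftrightarrow>
     I \<subseteq> V \<and> (\<forall>x\<in>I. \<forall>y\<in>I. \<forall>z\<in>V. x \<le> z \<and> z \<le> y \<longrightarrow> z \<in> I)"

definition interval_partite :: "nat \<Rightarrow> 'v::linorder ohgraph \<Rightarrow> bool" where
  "interval_partite r G \<longleftrightarrow>
     (\<exists>I :: nat \<Rightarrow> 'v set.
        (\<forall>j\<in>{1..r}. interval_of (verts G) (I j)) \<and>
        (\<forall>i\<in>{1..r}. \<forall>j\<in>{1..r}. i < j \<longrightarrow> (\<forall>x\<in>I i. \<forall>y\<in>I j. x < y)) \<and>
        (\<forall>e\<in>edges G. \<forall>j\<in>{1..r}. card (e \<inter> I j) = 1))"

definition iso_unordered :: "'a set set \<Rightarrow> 'v ohgraph \<Rightarrow> bool" where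
  "iso_unordered F G \<longleftrightarrow>
     (\<exists>\<phi>. bij_betw \<phi> (\<Union>F) (verts G) \<and> edges G = (\<lambda>e. \<phi> ` e) ` F)"

text \<open>
  Every finite linear order is isomorphic to a finite set of natural numbers, so ordered
  \<open>r\<close>-graphs on naturals represent all ordered \<open>r\<close>-graphs up to isomorphism.
\<close>

definition ord_family :: "nat \<Rightarrow> 'a set set \<Rightarrow> nat ohgraph set" where
  "ord_family r F = {G. ordered_rgraph r G \<and> interval_partite r G \<and> iso_unordered F G}"

definition ocontains :: "'v::linorder ohgraph \<Rightarrow> 'w::linorder ohgraph \<Rightarrow> bool" where
  "ocontains H G \<longleftrightarrow>
     (\<exists>\<phi>. strict_mono_on (verts G) \<phi> \<and> \<phi> ` verts G \<subseteq> verts H \<and>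
          (\<forall>e\<in>edges G. \<phi> ` e \<in> edges H))"

text \<open>
  The set below is always finite, so its supremum is a maximum whenever it is nonempty. It is
  empty only if every \<open>n\<close>-vertex ordered \<open>r\<close>-graph contains a member of \<open>\<G>\<close> (e.g. if \<open>\<G>\<close>
  contains the empty graph); the value is then 0.
\<close>

definition ex_ordered :: "nat \<Rightarrow> nat \<Rightarrow> nat ohgraph set \<Rightarrow> nat" where
  "ex_ordered r n \<G> =
     Sup {card (edges H) | H :: nat ohgraph.
            ordered_rgraph r H \<and> card (verts H) = n \<and> (\<forall>G\<in>\<G>. \<not> ocontains H G)}"

end

theory Submission
  imports Defs
begin

text \<open>
  Write edges as increasing lists and first suppose that the \<open>i\<close>-th vertices of all edges precede all
  their \<open>i'\<close>-th vertices for \<open>i < i'\<close>, except possibly for one pair \<open>i = j\<close>, \<open>i' = j + 1\<close>. For every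
  \<open>(r - 1)\<close>-set and every position, repeatedly delete the \<open>k\<close> edges whose vertex in that position
  lies furthest to the left (position at most \<open>j\<close>) or to the right (position above \<open>j\<close>). This costs
  \<open>O(n ^ (r - 1))\<close> edges; from any edge \<open>p0\<close> that survives, the tree can be embedded greedily with
  vertices in position \<open>j\<close> moving left of \<open>p0 ! j\<close> and those in position \<open>j + 1\<close> moving right of
  \<open>p0 ! (j + 1)\<close>, so the copy is interval \<open>r\<close>-partite. A general ordered \<open>r\<close>-graph is cut by
  dyadic intervals into such classes, whose bounds sum to \<open>O(n ^ (r - 1))\<close>.
\<close>

section \<open>Pruning edges with few replacements\<close>

definition better :: "nat \<Rightarrow> nat \<Rightarrow> 'v::linorder \<Rightarrow> 'v \<Rightarrow> bool" where
  "better j i x y \<longleftrightarrow> (if i \<le> j then x < y else y < x)"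

text \<open>Replacements need only lie in \<open>E\<close>, not in the core itself: this is a single
  pass of deletion, not a fixed point. Iterating it \<open>t\<close> times supports \<open>t\<close>
  successive extension steps.\<close>

definition core :: "nat \<Rightarrow> nat \<Rightarrow> nat \<Rightarrow> 'v::linorder list set \<Rightarrow> 'v list set" where
  "core j r k E = {p \<in> E. \<forall>i<r. k \<le> card {x. p[i := x] \<in> E \<and> better j i x (p ! i)}}"

lemma core_subset: "core j r k E \<subseteq> E"
  by (auto simp: core_def)

lemma core_funpow_subset: "(core j r k ^^ t) E \<subseteq> E"
  by (induction t) (use core_subset in fastforce)+

lemma better_trans: "better j i x y \<Longrightarrow> better j i y z \<Longrightarrow> better j i x z"
  by (auto simp: better_def split: if_splits)

text \<open>The number of predecessors within \<open>X\<close> strictly increases along the order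
  \<open>R\<close>, so it is injective on \<open>X\<close> and takes at most \<open>k\<close> values
  below \<open>k\<close>.\<close>

lemma card_few_predecessors_le:
  assumes "finite X" and trans: "\<And>x y z. R x y \<Longrightarrow> R y z \<Longrightarrow> R x z"
    and irrefl: "\<And>x. \<not> R x x" and total: "\<And>x y. x \<noteq> y \<Longrightarrow> R x y \<or> R y x"
  shows "card {x \<in> X. card {y \<in> X. R y x} < k} \<le> k"
proof -
  let ?f = "\<lambda>x. card {y \<in> X. R y x}"
  have less: "?f x < ?f y" if "R x y" "x \<in> X" for x y
  proof (rule psubset_card_mono)
    show "finite {z \<in> X. R z y}" using assms(1) by simp
    have "x \<in> {z \<in> X. R z y} - {z \<in> X. R z x}" using that irrefl by simp
    moreover have "{z \<in> X. R z x} \<subseteq> {z \<in> X. R z y}" using that trans by blast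
    ultimately show "{z \<in> X. R z x} \<subset> {z \<in> X. R z y}" by blast
  qed
  have "inj_on ?f {x \<in> X. ?f x < k}"
  proof (rule inj_onI)
    fix x y assume "x \<in> {x \<in> X. ?f x < k}" "y \<in> {x \<in> X. ?f x < k}" "?f x = ?f y"
    then show "x = y" using less[of x y] less[of y x] total[of x y] by fastforce
  qed
  then have "card {x \<in> X. ?f x < k} \<le> card {..<k}"
    by (rule card_inj_on_le) auto
  then show ?thesis by simp
qed

text \<open>Fixing the \<open>r - 1\<close> entries outside position \<open>i\<close> leaves a line
  of edges ordered by \<open>better j i\<close>, on which at most \<open>k\<close> points have fewer
  than \<open>k\<close> predecessors. There are at most \<open>card V ^ (r - 1)\<close> such
  lines.\<close>

lemma card_deficient_le:
  fixes E :: "'v::linorder list set"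
  assumes V: "finite V" and E: "E \<subseteq> {p. set p \<subseteq> V \<and> length p = r}" and i: "i < r"
  shows "card {p \<in> E. card {x. p[i := x] \<in> E \<and> better j i x (p ! i)} < k} \<le> k * card V ^ (r - 1)"
    (is "card ?B \<le> _")
proof -
  define h where "h p = take i p @ drop (Suc i) p" for p :: "'v list"
  define L where "L = {q. set q \<subseteq> V \<and> length q = r - 1}"
  have finL: "finite L" and cardL: "card L = card V ^ (r - 1)"
    using V by (simp_all add: L_def finite_lists_length_eq card_lists_length_eq)
  have hL: "h p \<in> L" if "p \<in> E" for p
  proof -
    have p: "set p \<subseteq> V" "length p = r" using that E by auto
    have "set (h p) \<subseteq> set p"
      using set_take_subset[of i p] set_drop_subset[of "Suc i" p] by (simp add: h_def)
    with p(1) have "set (h p) \<subseteq> V" by blast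
    then show ?thesis using p(2) i by (simp add: L_def h_def)
  qed
  have fibre: "card {p \<in> ?B. h p = q} \<le> k" for q
  proof -
    \<comment> \<open>\<open>X\<close> consists of the entries that complete \<open>q\<close> to an
      edge when inserted at position \<open>i\<close>; the replacements of an edge \<open>p\<close>
      on this line are the members of \<open>X\<close> that are better than
      \<open>p ! i\<close>.\<close>
    define X where "X = {x. take i q @ x # drop i q \<in> E}"
    have upd: "p[i := x] = take i q @ x # drop i q" if "p \<in> E" "h p = q" for p x
      using that E i by (auto simp: h_def upd_conv_take_nth_drop)
    have self: "p = take i q @ (p ! i) # drop i q" if "p \<in> E" "h p = q" for p
      using upd[OF that, of "p ! i"] by simp
    have "X \<subseteq> V" using E by (auto simp: X_def)
    then have finX: "finite X" using V finite_subset by blast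
    have "inj_on (\<lambda>p. p ! i) {p \<in> ?B. h p = q}"
    proof (rule inj_onI)
      fix p p' assume "p \<in> {p \<in> ?B. h p = q}" "p' \<in> {p \<in> ?B. h p = q}" and eq: "p ! i = p' ! i"
      then have "p \<in> E" "h p = q" "p' \<in> E" "h p' = q" by auto
      from self[OF this(1,2)] self[OF this(3,4)] show "p = p'" unfolding eq by (rule trans[OF _ sym])
    qed
    moreover have "(\<lambda>p. p ! i) ` {p \<in> ?B. h p = q} \<subseteq> {x \<in> X. card {y \<in> X. better j i y x} < k}"
    proof (rule image_subsetI)
      fix p assume p: "p \<in> {p \<in> ?B. h p = q}"
      then have "p ! i \<in> X" using self[of p] by (auto simp: X_def)
      moreover have "{y \<in> X. better j i y (p ! i)} = {x. p[i := x] \<in> E \<and> better j i x (p ! i)}"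
        using p upd by (auto simp: X_def)
      ultimately show "p ! i \<in> {x \<in> X. card {y \<in> X. better j i y x} < k}" using p by simp
    qed
    ultimately have "card {p \<in> ?B. h p = q} \<le> card {x \<in> X. card {y \<in> X. better j i y x} < k}"
      using finX by (intro card_inj_on_le) auto
    also have "\<dots> \<le> k"
      using finX by (rule card_few_predecessors_le) (auto simp: better_def split: if_splits)
    finally show ?thesis .
  qed
  have "?B = (\<Union>q\<in>L. {p \<in> ?B. h p = q})" using hL by auto
  then have "card ?B = card (\<Union>q\<in>L. {p \<in> ?B. h p = q})" by (rule arg_cong)
  also have "\<dots> \<le> (\<Sum>q\<in>L. card {p \<in> ?B. h p = q})"
    using finL by (rule card_UN_le)
  also have "\<dots> \<le> (\<Sum>q\<in>L. k)" by (intro sum_mono fibre)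
  finally show ?thesis by (simp add: cardL mult.commute)
qed

lemma card_le_card_core:
  fixes E :: "'v::linorder list set"
  assumes V: "finite V" and E: "E \<subseteq> {p. set p \<subseteq> V \<and> length p = r}"
  shows "card E \<le> card (core j r k E) + r * k * card V ^ (r - 1)"
proof -
  let ?B = "\<lambda>i. {p \<in> E. card {x. p[i := x] \<in> E \<and> better j i x (p ! i)} < k}"
  have "E = core j r k E \<union> (\<Union>i<r. ?B i)" by (auto simp: core_def not_le)
  then have "card E = card (core j r k E \<union> (\<Union>i<r. ?B i))" by (rule arg_cong)
  also have "\<dots> \<le> card (core j r k E) + card (\<Union>i<r. ?B i)" by (rule card_Un_le)
  also have "card (\<Union>i<r. ?B i) \<le> (\<Sum>i<r. card (?B i))" by (rule card_UN_le) simp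
  also have "\<dots> \<le> (\<Sum>i<r. k * card V ^ (r - 1))"
    using card_deficient_le[OF V E] by (intro sum_mono) auto
  finally show ?thesis by (simp add: mult.assoc)
qed

lemma card_le_card_core_funpow:
  fixes E :: "'v::linorder list set"
  assumes V: "finite V" and E: "E \<subseteq> {p. set p \<subseteq> V \<and> length p = r}"
  shows "card E \<le> card ((core j r k ^^ t) E) + t * (r * k * card V ^ (r - 1))"
proof (induction t)
  case (Suc t)
  have "(core j r k ^^ t) E \<subseteq> {p. set p \<subseteq> V \<and> length p = r}"
    using core_funpow_subset E by blast
  from card_le_card_core[OF V this, of j k] Suc show ?case by simp
qed simp

section \<open>Greedy embedding of uniform trees\<close>

lemma uniform_tree_finite_Union:
  "uniform_tree r T \<Longrightarrow> r \<ge> 2 \<Longrightarrow> finite (\<Union>T)"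
proof (induction rule: uniform_tree.induct)
  case (extend T f x)
  \<comment> \<open>\<open>card f = r - 1\<close> is positive, whereas infinite sets have
    cardinality 0.\<close>
  then have "finite f" by (auto simp: shadow_def intro: card_ge_0_finite)
  with extend show ?case by simp
qed simp

text \<open>\<open>\<kappa>\<close> assigns a position to each tree vertex and \<open>\<psi>\<close>
  places it in the host. Since no placement is worse than the entry of \<open>p0\<close>, the edge
  \<open>p0\<close> acts as a barrier between positions \<open>j\<close> and \<open>j + 1\<close>.
  The last clause makes the image of \<open>e\<close> the vertex set of a list in \<open>E\<close>
  once \<open>\<kappa>\<close> maps \<open>e\<close> bijectively onto the positions of that
  list.\<close>

definition embeds_beyond ::
    "('a \<Rightarrow> nat) \<Rightarrow> nat \<Rightarrow> 'v::linorder list \<Rightarrow> 'a set set \<Rightarrow> 'v list set \<Rightarrow> bool" where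
  "embeds_beyond \<kappa> j p0 T E \<longleftrightarrow> (\<exists>\<psi>. inj_on \<psi> (\<Union>T) \<and>
     (\<forall>x\<in>\<Union>T. \<psi> x = p0 ! \<kappa> x \<or> better j (\<kappa> x) (\<psi> x) (p0 ! \<kappa> x)) \<and>
     (\<forall>e\<in>T. \<exists>p\<in>E. \<forall>x\<in>e. p ! \<kappa> x = \<psi> x))"

text \<open>The edge of the tree that is added last is found in \<open>E\<close>, all the earlier ones already in
  \<open>core j r k E\<close>; hence one iteration of the core per edge suffices.\<close>

lemma uniform_tree_embedding:
  assumes "uniform_tree r T" and "r \<ge> 2"
  shows "\<exists>\<kappa> t. (\<forall>e\<in>T. bij_betw \<kappa> e {..<r}) \<and>
    (\<forall>(E :: 'v::linorder list set) j k p0.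
      (\<forall>p\<in>E. length p = r \<and> distinct p) \<longrightarrow> card (\<Union>T) < k \<longrightarrow> p0 \<in> (core j r k ^^ t) E \<longrightarrow>
      embeds_beyond \<kappa> j p0 T E)"
  using assms(1)
proof (induction rule: uniform_tree.induct)
  case (single e)
  then obtain \<kappa> where \<kappa>: "bij_betw \<kappa> e {..<r}"
    using ex_bij_betw_finite_nat atLeast0LessThan by metis
  have inj: "inj_on (\<lambda>x. p ! \<kappa> x) e" if "length p = r" "distinct p" for p :: "'v list"
    using \<kappa> that unfolding bij_betw_def inj_on_def
    by (metis distinct_conv_nth imageI lessThan_iff)
  have "embeds_beyond \<kappa> j p0 {e} E"
    if "\<forall>p\<in>E. length p = r \<and> distinct p" "p0 \<in> E" for E :: "'v list set" and j p0
    unfolding embeds_beyond_def using that inj by (intro exI[of _ "\<lambda>x. p0 ! \<kappa> x"]) auto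
  then have "(\<forall>e\<in>{e}. bij_betw \<kappa> e {..<r}) \<and> (\<forall>(E :: 'v list set) j k p0.
      (\<forall>p\<in>E. length p = r \<and> distinct p) \<longrightarrow> card (\<Union>{e}) < k \<longrightarrow> p0 \<in> (core j r k ^^ 0) E \<longrightarrow>
      embeds_beyond \<kappa> j p0 {e} E)"
    using \<kappa> by simp
  then show ?case by blast
next
  case (extend T f x)
  from extend.IH obtain \<kappa> t where \<kappa>: "\<And>e. e \<in> T \<Longrightarrow> bij_betw \<kappa> e {..<r}"
    and IH: "\<And>(E :: 'v list set) j k p0. (\<forall>p\<in>E. length p = r \<and> distinct p) \<Longrightarrow>
      card (\<Union>T) < k \<Longrightarrow> p0 \<in> (core j r k ^^ t) E \<Longrightarrow> embeds_beyond \<kappa> j p0 T E"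
    by metis
  from extend.hyps obtain e where e: "e \<in> T" "f \<subseteq> e" and cf: "card f = r - 1"
    by (auto simp: shadow_def)
  have fin: "finite (\<Union>T)" using extend.hyps(1) assms(2) by (rule uniform_tree_finite_Union)
  then have fine: "finite e" using e by (meson Union_upper finite_subset)
  have ce: "card e = r" using \<kappa>[OF e(1)] bij_betw_same_card by fastforce
  have "card (e - f) = 1" using e cf ce fine assms(2) by (simp add: card_Diff_subset finite_subset)
  then obtain y where y: "e - f = {y}" by (auto simp: card_1_singleton_iff)
  then have ey: "e = insert y f" "y \<notin> f" using e by auto
  have xT: "x \<noteq> v" if "v \<in> \<Union>T" for v using extend.hyps that by blast
  have xe: "x \<notin> e" using e extend.hyps by blast
  have fT: "f \<subseteq> \<Union>T" using e by blast
  have yr: "\<kappa> y < r" using \<kappa>[OF e(1)] ey by (auto simp: bij_betw_def)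
  \<comment> \<open>The new vertex inherits the position of \<open>y\<close>, the one vertex of
    \<open>e\<close> missing from \<open>f\<close>, so the new edge again uses every position
    once.\<close>
  let ?\<kappa> = "\<kappa>(x := \<kappa> y)"
  have bij: "bij_betw ?\<kappa> e' {..<r}" if "e' \<in> insert (f \<union> {x}) T" for e'
  proof (cases "e' \<in> T")
    case True
    then have "\<And>v. v \<in> e' \<Longrightarrow> ?\<kappa> v = \<kappa> v" using xT by fastforce
    then show ?thesis using \<kappa>[OF True] bij_betw_cong by metis
  next
    case False
    then have e': "e' = insert x f" using that by auto
    have "inj_on \<kappa> (insert y f)" "\<kappa> ` (insert y f) = {..<r}"
      using \<kappa>[OF e(1)] ey by (auto simp: bij_betw_def)
    moreover have "x \<notin> f" using xe ey by auto
    ultimately show ?thesis using ey(2) unfolding e' bij_betw_def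
      by (auto simp: inj_on_def)
  qed
  have step: "embeds_beyond ?\<kappa> j p0 (insert (f \<union> {x}) T) E"
    if E: "\<forall>p\<in>E. length p = r \<and> distinct p" and k: "card (\<Union>(insert (f \<union> {x}) T)) < k"
      and p0: "p0 \<in> (core j r k ^^ Suc t) E" for E :: "'v list set" and j k p0
  proof -
    have UT: "\<Union>(insert (f \<union> {x}) T) = insert x (\<Union>T)" using fT by auto
    have xU: "x \<notin> \<Union>T" by (rule extend.hyps)
    have k': "card (\<Union>T) < k" using k fin xU unfolding UT by simp
    \<comment> \<open>One core is peeled off on the inside, so that the induction hypothesis applies
      with \<open>core j r k E\<close> in place of \<open>E\<close>.\<close>
    have "p0 \<in> (core j r k ^^ t) (core j r k E)" using p0 by (simp only: funpow_Suc_right o_def)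
    moreover have "\<forall>p\<in>core j r k E. length p = r \<and> distinct p" using E core_subset by blast
    ultimately obtain \<psi> where inj: "inj_on \<psi> (\<Union>T)"
      and bet: "\<And>v. v \<in> \<Union>T \<Longrightarrow> \<psi> v = p0 ! \<kappa> v \<or> better j (\<kappa> v) (\<psi> v) (p0 ! \<kappa> v)"
      and img: "\<And>e. e \<in> T \<Longrightarrow> \<exists>p\<in>core j r k E. \<forall>v\<in>e. p ! \<kappa> v = \<psi> v"
      using IH[of "core j r k E" k p0 j] k' unfolding embeds_beyond_def by metis
    from img[OF e(1)] obtain p where p: "p \<in> core j r k E" "\<And>v. v \<in> e \<Longrightarrow> p ! \<kappa> v = \<psi> v" by blast
    \<comment> \<open>At least \<open>k\<close> entries can replace that of \<open>y\<close> in
      \<open>p\<close>, and fewer than \<open>k\<close> host vertices are occupied, so a fresh one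
      remains for \<open>x\<close>.\<close>
    let ?Z = "{z. p[\<kappa> y := z] \<in> E \<and> better j (\<kappa> y) z (p ! \<kappa> y)}"
    have "k \<le> card ?Z" using p(1) yr by (simp add: core_def)
    moreover have "card (\<psi> ` \<Union>T) \<le> card (\<Union>T)" using fin by (rule card_image_le)
    ultimately have "\<not> ?Z \<subseteq> \<psi> ` \<Union>T"
      using k' card_mono[OF finite_imageI[OF fin], of ?Z \<psi>] by linarith
    then obtain z where z: "p[\<kappa> y := z] \<in> E" "better j (\<kappa> y) z (p ! \<kappa> y)" "z \<notin> \<psi> ` \<Union>T" by blast
    have lenp: "length p = r" using p(1) E core_subset by blast
    let ?\<psi> = "\<psi>(x := z)"
    have "inj_on ?\<psi> (insert x (\<Union>T))"
      using inj z(3) xU by (auto simp: inj_on_def)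
    moreover have "?\<psi> v = p0 ! ?\<kappa> v \<or> better j (?\<kappa> v) (?\<psi> v) (p0 ! ?\<kappa> v)"
      if "v \<in> insert x (\<Union>T)" for v
    proof (cases "v = x")
      case True
      have "y \<in> \<Union>T" using e ey by auto
      \<comment> \<open>By transitivity: \<open>z\<close> is better than \<open>\<psi> y\<close>,
        which equals or is better than the entry of \<open>p0\<close> in the same position.\<close>
      from bet[OF this] show ?thesis using True z(2) p(2)[of y] ey better_trans by fastforce
    next
      case False
      then show ?thesis using bet[of v] that by simp
    qed
    moreover have "\<exists>p\<in>E. \<forall>v\<in>e'. p ! ?\<kappa> v = ?\<psi> v" if "e' \<in> insert (f \<union> {x}) T" for e'
    proof (cases "e' \<in> T")
      case True
      from img[OF this] core_subset obtain q where "q \<in> E" "\<And>v. v \<in> e' \<Longrightarrow> q ! \<kappa> v = \<psi> v" by blast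
      moreover have "\<And>v. v \<in> e' \<Longrightarrow> v \<noteq> x" using xT True by blast
      ultimately show ?thesis by (intro bexI[of _ q]) auto
    next
      case False
      then have e': "e' = insert x f" using that by auto
      \<comment> \<open>No vertex of \<open>f\<close> has the position of \<open>y\<close>, so the
        update of \<open>p\<close> does not disturb their placement.\<close>
      have "\<kappa> y \<noteq> \<kappa> v" if "v \<in> f" for v
        using \<kappa>[OF e(1)] ey that by (auto simp: bij_betw_def inj_on_def)
      then have "\<forall>v\<in>e'. p[\<kappa> y := z] ! ?\<kappa> v = ?\<psi> v"
        using e' yr lenp p(2) ey xe by auto
      then show ?thesis using z(1) by (rule bexI)
    qed
    ultimately show ?thesis
      unfolding embeds_beyond_def UT by (intro exI[of _ ?\<psi>] conjI ballI)
  qed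
  show ?case
    by (rule exI[of _ ?\<kappa>], rule exI[of _ "Suc t"], rule conjI, rule ballI, erule bij,
        intro allI impI, rule step)
qed

section \<open>Interval partite copies and the bound for separated classes\<close>

text \<open>The image of \<open>F\<close> under \<open>\<psi>\<close> is itself the member,
  contained in \<open>H\<close> through the identity. Its parts are the images of the classes of
  \<open>\<kappa>\<close>; they are intervals because \<open>\<psi>\<close> respects the order of
  the classes.\<close>

lemma ord_family_member_contained:
  fixes H :: "nat ohgraph"
  assumes fin: "finite (\<Union>F)" and inj: "inj_on \<psi> (\<Union>F)"
    and \<kappa>: "\<And>e. e \<in> F \<Longrightarrow> bij_betw \<kappa> e {..<r}"
    and mono: "\<And>x y. x \<in> \<Union>F \<Longrightarrow> y \<in> \<Union>F \<Longrightarrow> \<kappa> x < \<kappa> y \<Longrightarrow> \<psi> x < \<psi> y"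
    and H: "ordered_rgraph r H" "\<And>e. e \<in> F \<Longrightarrow> \<psi> ` e \<in> edges H"
  shows "\<exists>G\<in>ord_family r F. ocontains H G"
proof -
  define G where "G = (\<psi> ` \<Union>F, (\<lambda>e. \<psi> ` e) ` F)"
  \<comment> \<open>Parts are numbered from 1 but positions from 0, hence the shift.\<close>
  define I where "I i = \<psi> ` {x \<in> \<Union>F. \<kappa> x = i - 1}" for i
  have vG: "verts G = \<psi> ` \<Union>F" and eG: "edges G = (\<lambda>e. \<psi> ` e) ` F"
    by (simp_all add: G_def verts_def edges_def)
  have sub: "e \<subseteq> \<Union>F" if "e \<in> F" for e using that by blast
  have "iso_unordered F G"
    unfolding iso_unordered_def using inj by (intro exI[of _ \<psi>]) (simp add: vG eG bij_betw_def)
  moreover have "card (\<psi> ` e) = r" if "e \<in> F" for e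
    using \<kappa>[OF that] bij_betw_same_card[of \<kappa> e] card_image[OF inj_on_subset[OF inj sub[OF that]]]
    by simp
  then have "ordered_rgraph r G"
    using fin sub by (fastforce simp: ordered_rgraph_def vG eG)
  moreover have "interval_partite r G"
    unfolding interval_partite_def
  proof (intro exI[of _ I] conjI ballI impI)
    fix i assume "i \<in> {1..r}"
    show "interval_of (verts G) (I i)"
      unfolding interval_of_def
    proof (intro conjI ballI impI)
      show "I i \<subseteq> verts G" by (auto simp: I_def vG)
      fix u v w assume "u \<in> I i" "v \<in> I i" "w \<in> verts G" and le: "u \<le> w \<and> w \<le> v"
      then obtain x y z where xyz: "x \<in> \<Union>F" "y \<in> \<Union>F" "z \<in> \<Union>F" "\<kappa> x = i - 1" "\<kappa> y = i - 1"
        "u = \<psi> x" "v = \<psi> y" "w = \<psi> z" by (auto simp: I_def vG)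
      have "\<not> \<kappa> z < \<kappa> x" using mono[of z x] xyz le by linarith
      moreover have "\<not> \<kappa> y < \<kappa> z" using mono[of y z] xyz le by linarith
      ultimately have "\<kappa> z = i - 1" using xyz by linarith
      then show "w \<in> I i" using xyz by (auto simp: I_def)
    qed
  next
    fix i j u v assume "i \<in> {1..r}" "j \<in> {1..r}" "i < j" "u \<in> I i" "v \<in> I j"
    then show "u < v" by (auto simp: I_def intro!: mono)
  next
    fix e' i assume e': "e' \<in> edges G" and i: "i \<in> {1..r}"
    then obtain e where e: "e \<in> F" "e' = \<psi> ` e" by (auto simp: eG)
    have "i - 1 \<in> \<kappa> ` e" using \<kappa>[OF e(1)] i by (auto simp: bij_betw_def)
    then obtain x where x: "x \<in> e" "\<kappa> x = i - 1" by auto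
    have "e' \<inter> I i = {\<psi> x}"
    proof
      show "{\<psi> x} \<subseteq> e' \<inter> I i" using x e by (auto simp: I_def)
      show "e' \<inter> I i \<subseteq> {\<psi> x}"
      proof
        fix u assume "u \<in> e' \<inter> I i"
        then obtain y z where yz: "y \<in> e" "u = \<psi> y" "z \<in> \<Union>F" "\<kappa> z = i - 1" "u = \<psi> z"
          unfolding I_def e(2) by blast
        then have "y = z" using inj e(1) by (auto simp: inj_on_def)
        then have "y = x" using \<kappa>[OF e(1)] x yz by (auto simp: bij_betw_def inj_on_def)
        then show "u \<in> {\<psi> x}" using yz by simp
      qed
    qed
    then show "card (e' \<inter> I i) = 1" by simp
  qed
  moreover have "ocontains H G"
    unfolding ocontains_def
  proof (intro exI[of _ "\<lambda>x. x"] conjI ballI)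
    show "(\<lambda>x. x) ` verts G \<subseteq> verts H"
      using H by (fastforce simp: vG ordered_rgraph_def)
  qed (use H in \<open>auto simp: eG strict_mono_on_def\<close>)
  ultimately show ?thesis unfolding ord_family_def by blast
qed

text \<open>Entries of different edges are compared, since two tree vertices need not share an edge.
  The exempt pair makes room for the single coincidence that a block pattern may have; if
  \<open>Suc j \<ge> r\<close>, nothing is exempt.\<close>

definition separated :: "nat \<Rightarrow> nat \<Rightarrow> 'v::linorder list set \<Rightarrow> bool" where
  "separated j r E \<longleftrightarrow>
     (\<forall>p\<in>E. \<forall>q\<in>E. \<forall>i i'. i < i' \<longrightarrow> i' < r \<longrightarrow> \<not> (i = j \<and> i' = Suc j) \<longrightarrow> p ! i < q ! i')"

lemma separatedD:
  "separated j r E \<Longrightarrow> p \<in> E \<Longrightarrow> q \<in> E \<Longrightarrow> i < i' \<Longrightarrow> i' < r \<Longrightarrow> \<not> (i = j \<and> i' = Suc j) \<Longrightarrow>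
    p ! i < q ! i'"
  by (simp add: separated_def)

text \<open>If an edge survived \<open>t\<close> passes, the tree would embed beyond it and a
  forbidden member would appear. So the passes delete all of \<open>E\<close>, which bounds its
  size. The constant is uniform in \<open>V\<close>, so a class living on few vertices gets a
  correspondingly small bound.\<close>

lemma card_separated_le:
  fixes F :: "'a set set"
  assumes r: "r \<ge> 2" and F: "uniform_forest r F"
  shows "\<exists>C. \<forall>(H :: nat ohgraph) V E j. ordered_rgraph r H \<longrightarrow>
    (\<forall>G\<in>ord_family r F. \<not> ocontains H G) \<longrightarrow> E \<subseteq> sorted_list_of_set ` edges H \<longrightarrow>
    finite V \<longrightarrow> (\<forall>p\<in>E. set p \<subseteq> V) \<longrightarrow> separated j r E \<longrightarrow> card E \<le> C * card V ^ (r - 1)"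
proof -
  obtain T where T: "uniform_tree r T" "F \<subseteq> T" using F by (auto simp: uniform_forest_def)
  obtain \<kappa> t where \<kappa>: "\<And>e. e \<in> T \<Longrightarrow> bij_betw \<kappa> e {..<r}"
    and emb: "\<And>(E :: nat list set) j k p0. (\<forall>p\<in>E. length p = r \<and> distinct p) \<Longrightarrow>
      card (\<Union>T) < k \<Longrightarrow> p0 \<in> (core j r k ^^ t) E \<Longrightarrow> embeds_beyond \<kappa> j p0 T E"
    using uniform_tree_embedding[OF T(1) r, where 'v = nat] by metis
  define k where "k = Suc (card (\<Union>T))"
  have finT: "finite (\<Union>T)" using T(1) r by (rule uniform_tree_finite_Union)
  have FT: "\<Union>F \<subseteq> \<Union>T" using T(2) by blast
  have "card E \<le> t * (r * k) * card V ^ (r - 1)"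
    if H: "ordered_rgraph r H" and free: "\<forall>G\<in>ord_family r F. \<not> ocontains H G"
      and E: "E \<subseteq> sorted_list_of_set ` edges H" and V: "finite V" "\<forall>p\<in>E. set p \<subseteq> V"
      and sep: "separated j r E"
    for H :: "nat ohgraph" and V E j
  proof -
    have E': "length p = r \<and> sorted_wrt (<) p \<and> set p \<in> edges H" if pE: "p \<in> E" for p
    proof -
      obtain e where e: "e \<in> edges H" "p = sorted_list_of_set e" using pE E by blast
      then have "card e = r" using H by (auto simp: ordered_rgraph_def)
      moreover from this have "finite e" using r by (intro card_ge_0_finite) auto
      ultimately show ?thesis using e strict_sorted_list_of_set by simp
    qed
    then have E'': "\<forall>p\<in>E. length p = r \<and> distinct p"
      using strict_sorted_iff by blast
    have "(core j r k ^^ t) E = {}"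
    proof (rule ccontr)
      assume "(core j r k ^^ t) E \<noteq> {}"
      then obtain p0 where p0: "p0 \<in> (core j r k ^^ t) E" by blast
      then have p0E: "p0 \<in> E" using core_funpow_subset by blast
      have "embeds_beyond \<kappa> j p0 T E" using emb[OF E'' _ p0] by (simp add: k_def)
      then obtain \<psi> where inj: "inj_on \<psi> (\<Union>T)"
        and bet: "\<And>x. x \<in> \<Union>T \<Longrightarrow> \<psi> x = p0 ! \<kappa> x \<or> better j (\<kappa> x) (\<psi> x) (p0 ! \<kappa> x)"
        and img: "\<And>e. e \<in> T \<Longrightarrow> \<exists>p\<in>E. \<forall>x\<in>e. p ! \<kappa> x = \<psi> x"
        unfolding embeds_beyond_def by metis
      have mono: "\<psi> x < \<psi> y" if xy: "x \<in> \<Union>T" "y \<in> \<Union>T" "\<kappa> x < \<kappa> y" for x y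
      proof (cases "\<kappa> x = j \<and> \<kappa> y = Suc j")
        case True
        have "\<kappa> y < r" using \<kappa> xy(2) by (auto simp: bij_betw_def)
        \<comment> \<open>For the exempt pair the barrier decides:
          \<open>\<psi> x \<le> p0 ! j < p0 ! Suc j \<le> \<psi> y\<close>.\<close>
        then have "p0 ! j < p0 ! Suc j"
          using E'[OF p0E] True by (auto simp: sorted_wrt_iff_nth_less)
        then show ?thesis using bet[OF xy(1)] bet[OF xy(2)] True by (auto simp: better_def)
      next
        case False
        obtain d e where de: "x \<in> d" "d \<in> T" "y \<in> e" "e \<in> T" using xy by auto
        obtain p where p: "p \<in> E" "p ! \<kappa> x = \<psi> x" using img[OF de(2)] de(1) by auto
        obtain q where q: "q \<in> E" "q ! \<kappa> y = \<psi> y" using img[OF de(4)] de(3) by auto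
        have "\<kappa> y < r" using \<kappa>[OF de(4)] de(3) by (auto simp: bij_betw_def)
        from separatedD[OF sep p(1) q(1) xy(3) this False] show ?thesis
          unfolding p(2) q(2) .
      qed
      have edge: "\<psi> ` e \<in> edges H" if e: "e \<in> T" for e
      proof -
        obtain p where p: "p \<in> E" "\<And>x. x \<in> e \<Longrightarrow> p ! \<kappa> x = \<psi> x" using img[OF e] by blast
        have "\<psi> ` e = (!) p ` \<kappa> ` e" using p(2) by (force simp: image_image)
        also have "\<dots> = (!) p ` {..<r}" using \<kappa>[OF e] by (simp add: bij_betw_def)
        also have "\<dots> = set p" using E'[OF p(1)] by (auto simp: set_conv_nth)
        finally show ?thesis using E'[OF p(1)] by simp
      qed
      have "\<exists>G\<in>ord_family r F. ocontains H G"
      proof (rule ord_family_member_contained)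
        show "finite (\<Union>F)" using finT FT finite_subset by blast
        show "inj_on \<psi> (\<Union>F)" using inj FT inj_on_subset by blast
        show "\<And>e. e \<in> F \<Longrightarrow> bij_betw \<kappa> e {..<r}" using \<kappa> T(2) by blast
        show "\<And>x y. x \<in> \<Union>F \<Longrightarrow> y \<in> \<Union>F \<Longrightarrow> \<kappa> x < \<kappa> y \<Longrightarrow> \<psi> x < \<psi> y" using mono FT by blast
        show "\<And>e. e \<in> F \<Longrightarrow> \<psi> ` e \<in> edges H" using edge T(2) by blast
      qed (rule H)
      then show False using free by blast
    qed
    moreover have "E \<subseteq> {p. set p \<subseteq> V \<and> length p = r}" using V(2) E'' by auto
    ultimately show ?thesis
      using card_le_card_core_funpow[OF V(1), of E r t j k] by (simp add: mult.assoc)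
  qed
  then show ?thesis by blast
qed

section \<open>Block patterns: coincidences and counting\<close>

text \<open>In a sorted list equal entries are consecutive, and the cardinality allows only one
  repetition; \<open>j\<close> and \<open>Suc j\<close> are its two places. Without a repetition any
  \<open>j\<close> will do.\<close>

lemma sorted_almost_distinct:
  fixes b :: "'b::linorder list"
  assumes "sorted b" and card: "length b - 1 \<le> card (set b)"
  obtains j where "\<And>i i'. i < i' \<Longrightarrow> i' < length b \<Longrightarrow> \<not> (i = j \<and> i' = Suc j) \<Longrightarrow> b ! i < b ! i'"
proof (cases "distinct b")
  case True
  then have "sorted_wrt (<) b" using assms(1) strict_sorted_iff by blast
  then show ?thesis using that by (auto simp: sorted_wrt_iff_nth_less)
next
  case False
  then obtain j m where jm: "j < m" "m < length b" "b ! j = b ! m"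
    unfolding distinct_conv_nth by (metis linorder_neqE_nat)
  have "b ! j \<le> b ! Suc j" using assms(1) jm by (intro sorted_nth_mono) auto
  moreover have "b ! Suc j \<le> b ! m" using assms(1) jm by (intro sorted_nth_mono) auto
  ultimately have eq: "b ! Suc j = b ! j" using jm by simp
  \<comment> \<open>Dropping the index \<open>Suc j\<close> loses no value, so the remaining
    \<open>length b - 1\<close> indices must carry distinct values.\<close>
  let ?I = "{..<length b} - {Suc j}"
  have "set b = (!) b ` {..<length b}" by (auto simp: set_conv_nth)
  also have "\<dots> = (!) b ` ?I"
  proof
    show "(!) b ` {..<length b} \<subseteq> (!) b ` ?I"
    proof (rule image_subsetI)
      fix x assume "x \<in> {..<length b}"
      moreover have "b ! Suc j \<in> (!) b ` ?I" unfolding eq by (rule imageI) (use jm in auto)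
      ultimately show "b ! x \<in> (!) b ` ?I" by (cases "x = Suc j") auto
    qed
  qed auto
  finally have "card (set b) = card ((!) b ` ?I)" by simp
  moreover have "card ?I = length b - 1" using jm by simp
  moreover have "card ((!) b ` ?I) \<le> card ?I" by (rule card_image_le) simp
  ultimately have "card ((!) b ` ?I) = card ?I" using card by linarith
  then have inj: "inj_on ((!) b) ?I" by (intro eq_card_imp_inj_on) auto
  show ?thesis
  proof (rule that[of j])
    fix i i' assume i: "i < i'" "i' < length b" "\<not> (i = j \<and> i' = Suc j)"
    have "b ! i \<noteq> b ! i'"
    proof
      assume *: "b ! i = b ! i'"
      consider "i = Suc j" | "i' = Suc j" | "i \<in> ?I" "i' \<in> ?I" using i by auto
      then show False
      proof cases
        case 1
        then show ?thesis using inj_onD[OF inj, of j i'] eq * i jm by auto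
      next
        case 2
        then show ?thesis using inj_onD[OF inj, of i j] eq * i jm by auto
      next
        case 3
        then show ?thesis using inj_onD[OF inj *] i by auto
      qed
    qed
    moreover have "b ! i \<le> b ! i'" using assms(1) i by (auto intro: sorted_nth_mono)
    ultimately show "b ! i < b ! i'" by simp
  qed
qed

text \<open>List the halves in some \<open>s\<close> of length \<open>m\<close>, in at most
  \<open>N ^ m\<close> ways; each of the \<open>r\<close> entries of \<open>b\<close> is then one of
  at most \<open>2 * m\<close> numbers whose half occurs in \<open>s\<close>.\<close>

lemma card_lists_with_few_halves_le:
  assumes "m > 0" and "r > 0"
  shows "finite {b :: nat list. length b = r \<and> set b \<subseteq> {..<N} \<and> card ((\<lambda>y. y div 2) ` set b) \<le> m}"
      (is "finite ?B")
    and "card {b :: nat list. length b = r \<and> set b \<subseteq> {..<N} \<and> card ((\<lambda>y. y div 2) ` set b) \<le> m}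
      \<le> N ^ m * (2 * m) ^ r"
proof -
  define S where "S = {s :: nat list. set s \<subseteq> {..<N} \<and> length s = m}"
  define D where "D s = {y :: nat. y div 2 \<in> set s}" for s
  define L where "L s = {b. set b \<subseteq> D s \<and> length b = r}" for s
  have D: "finite (D s) \<and> card (D s) \<le> 2 * length s" for s
  proof -
    have "D s \<subseteq> (\<lambda>(c, d). 2 * c + d) ` (set s \<times> {0, 1})"
    proof
      fix y assume "y \<in> D s"
      moreover have "y = (\<lambda>(c, d). 2 * c + d) (y div 2, y mod 2)" by simp
      moreover have "y mod 2 \<in> {0, 1}" by auto
      ultimately show "y \<in> (\<lambda>(c, d). 2 * c + d) ` (set s \<times> {0, 1})"
        unfolding D_def by (intro image_eqI[of _ _ "(y div 2, y mod 2)"]) auto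
    qed
    moreover have "card ((\<lambda>(c, d). 2 * c + d) ` (set s \<times> {0, 1 :: nat})) \<le> card (set s \<times> {0, 1 :: nat})"
      by (rule card_image_le) simp
    moreover have "card (set s \<times> {0, 1 :: nat}) \<le> 2 * length s"
      using card_length[of s] by simp
    ultimately show ?thesis
      by (meson card_mono finite.emptyI finite.insertI finite_SigmaI finite_imageI finite_set
          finite_subset le_trans)
  qed
  have finS: "finite S" and cS: "card S = N ^ m"
    by (simp_all add: S_def finite_lists_length_eq card_lists_length_eq)
  have cL: "card (L s) \<le> (2 * m) ^ r" if "s \<in> S" for s
  proof -
    have "card (L s) = card (D s) ^ r" using D by (simp add: L_def card_lists_length_eq)
    also have "\<dots> \<le> (2 * m) ^ r" using that D[of s] by (intro power_mono) (auto simp: S_def)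
    finally show ?thesis .
  qed
  have sub: "?B \<subseteq> (\<Union>s\<in>S. L s)"
  proof
    fix b assume b: "b \<in> ?B"
    let ?C = "(\<lambda>y. y div 2) ` set b"
    \<comment> \<open>An arbitrary half \<open>c\<close>, available since \<open>b\<close> is
      nonempty, pads the list of halves to length exactly \<open>m\<close>.\<close>
    obtain c where c: "c \<in> ?C" using b assms(2) by (cases b) auto
    obtain xs where xs: "set xs = ?C" "distinct xs" using finite_distinct_list[of ?C] by auto
    then have "length xs \<le> m" using b distinct_card[of xs] by simp
    then have "length (xs @ replicate (m - length xs) c) = m"
      and "set (xs @ replicate (m - length xs) c) = ?C" using c xs(1) by (auto simp: set_replicate_conv_if)
    moreover have "?C \<subseteq> {..<N}" using b by auto
    ultimately have "xs @ replicate (m - length xs) c \<in> S"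
      and "b \<in> L (xs @ replicate (m - length xs) c)"
      using b unfolding S_def L_def D_def by auto
    then show "b \<in> (\<Union>s\<in>S. L s)" by blast
  qed
  have finU: "finite (\<Union>s\<in>S. L s)"
    using finS D by (auto simp: L_def intro!: finite_lists_length_eq)
  then show "finite ?B" using sub finite_subset by blast
  have "card ?B \<le> card (\<Union>s\<in>S. L s)" using finU sub by (rule card_mono)
  also have "\<dots> \<le> (\<Sum>s\<in>S. card (L s))" using finS by (rule card_UN_le)
  also have "\<dots> \<le> (\<Sum>s\<in>S. (2 * m) ^ r)" by (intro sum_mono cL)
  finally show "card ?B \<le> N ^ m * (2 * m) ^ r" by (simp add: cS)
qed

section \<open>Dyadic decomposition of the edge set\<close>

text \<open>Ranks identify \<open>V\<close> with an initial segment of the naturals, so that blocks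
  of consecutive vertices become quotients by the block length.\<close>

definition rank :: "'v::linorder set \<Rightarrow> 'v \<Rightarrow> nat" where
  "rank V x = card {y \<in> V. y < x}"

lemma rank_mono: "finite V \<Longrightarrow> x \<le> y \<Longrightarrow> rank V x \<le> rank V y"
  unfolding rank_def by (intro card_mono) auto

lemma rank_strict_mono: "finite V \<Longrightarrow> x \<in> V \<Longrightarrow> x < y \<Longrightarrow> rank V x < rank V y"
  unfolding rank_def by (intro psubset_card_mono) auto

lemma rank_less_card: "finite V \<Longrightarrow> x \<in> V \<Longrightarrow> rank V x < card V"
  unfolding rank_def by (intro psubset_card_mono) auto

lemma inj_on_rank: "finite V \<Longrightarrow> inj_on (rank V) V"
  using rank_strict_mono by (metis (mono_tags) inj_onI less_irrefl linorder_neqE)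

lemma card_rank_blocks_le:
  assumes "finite V" and "finite S" and "0 < d"
  shows "card {v \<in> V. rank V v div d \<in> S} \<le> card S * d"
proof -
  have "rank V ` {v \<in> V. rank V v div d \<in> S} \<subseteq> (\<Union>s\<in>S. {s * d..<s * d + d})"
  proof (rule image_subsetI)
    fix v assume v: "v \<in> {v \<in> V. rank V v div d \<in> S}"
    have "rank V v \<in> {rank V v div d * d..<rank V v div d * d + d}"
      using dividend_less_div_times[OF assms(3), of "rank V v"] by (simp add: add.commute)
    then show "rank V v \<in> (\<Union>s\<in>S. {s * d..<s * d + d})" using v by blast
  qed
  moreover have "inj_on (rank V) {v \<in> V. rank V v div d \<in> S}"
    using inj_on_rank[OF assms(1)] by (rule inj_on_subset) auto
  ultimately have "card {v \<in> V. rank V v div d \<in> S} \<le> card (\<Union>s\<in>S. {s * d..<s * d + d})"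
    using assms(2) by (intro card_inj_on_le) auto
  also have "\<dots> \<le> (\<Sum>s\<in>S. card {s * d..<s * d + d})" using assms(2) by (rule card_UN_le)
  finally show ?thesis by simp
qed

text \<open>For an edge \<open>p\<close> let \<open>a\<close> be the last scale at which its vertices lie in at least \<open>r - 1\<close> blocks
  of \<open>2 ^ a\<close> consecutive vertices. As at the next scale there are at most \<open>r - 2\<close> blocks, only
  \<open>O((n / 2 ^ a) ^ (r - 2))\<close> block patterns arise, each with \<open>O((2 ^ a) ^ (r - 1))\<close> edges, and
  summing over \<open>a\<close> gives a geometric series dominated by its last term.\<close>

lemma card_le_by_dyadic_blocks:
  fixes E :: "'v::linorder list set"
  assumes r: "r \<ge> 3" and V: "finite V"
    and E: "\<And>p. p \<in> E \<Longrightarrow> length p = r \<and> sorted_wrt (<) p \<and> set p \<subseteq> V"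
    and C: "\<And>E' V' j. E' \<subseteq> E \<Longrightarrow> finite V' \<Longrightarrow> (\<forall>p\<in>E'. set p \<subseteq> V') \<Longrightarrow> separated j r E' \<Longrightarrow>
      card E' \<le> C * card V' ^ (r - 1)"
  shows "card E \<le> (2 * (r - 2)) ^ r * C * r ^ (r - 1) * 2 ^ (r - 1) * card V ^ (r - 1)"
proof (cases "E = {}")
  case False
  define n where "n = card V"
  define \<beta> where "\<beta> a x = rank V x div 2 ^ a" for a :: nat and x
  have \<beta>_Suc: "\<beta> (Suc a) x = \<beta> a x div 2" for a x
    by (simp only: \<beta>_def power_Suc2 div_mult2_eq)
  have \<beta>_mono: "\<beta> a x \<le> \<beta> a y" if "x \<le> y" for a x y
    using rank_mono[OF V that] by (simp add: \<beta>_def div_le_mono)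
  obtain p where "p \<in> E" using False by blast
  then have "V \<noteq> {}" using E[of p] r by auto
  then have "1 \<le> n" using V by (simp add: n_def Suc_leI card_gt_0_iff)
  \<comment> \<open>Scale \<open>A + 1\<close> is the first at which all of \<open>V\<close> is a
    single block.\<close>
  then obtain A where A: "2 ^ A \<le> n" "n < 2 ^ (A + 1)" using ex_power_ivl1[of 2 n] by auto
  define N where "N a = n div 2 ^ a + 1" for a
  define Bs where "Bs a = {b :: nat list. length b = r \<and> set b \<subseteq> {..<N a} \<and>
    card ((\<lambda>y. y div 2) ` set b) \<le> r - 2}" for a
  define cls where "cls a b = {p \<in> E. map (\<beta> a) p = b \<and> r - 1 \<le> card (set b)}" for a b
  have finBs: "finite (Bs a)" and cardBs: "card (Bs a) \<le> N a ^ (r - 2) * (2 * (r - 2)) ^ r" for a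
    using card_lists_with_few_halves_le[of "r - 2" r "N a"] r by (simp_all add: Bs_def)
  have cover: "E \<subseteq> (\<Union>a\<le>A. \<Union>b\<in>Bs a. cls a b)"
  proof
    fix p assume p: "p \<in> E"
    define P where "P a \<longleftrightarrow> r - 1 \<le> card (set (map (\<beta> a) p))" for a
    have pV: "set p \<subseteq> V" "length p = r" "distinct p" using E[OF p] strict_sorted_iff by auto
    have "set (map (\<beta> (Suc A)) p) \<subseteq> {0}"
      using pV(1) rank_less_card[OF V] A(2) by (fastforce simp: \<beta>_def n_def)
    then have "card (set (map (\<beta> (Suc A)) p)) \<le> 1"
      using card_mono[of "{0::nat}"] by fastforce
    \<comment> \<open>This uses \<open>1 < r - 1\<close>; the case \<open>r = 2\<close> is therefore
      not treated by blocks.\<close>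
    then have top: "\<not> P (Suc A)" using r by (simp add: P_def)
    have "card (\<beta> 0 ` set p) = r"
      using pV inj_on_subset[OF inj_on_rank[OF V] pV(1)]
      by (simp add: \<beta>_def card_image distinct_card)
    then have "P 0" by (simp add: P_def)
    then obtain a where a: "a < Suc A" "P a" "\<not> P (Suc a)"
      using ex_least_nat_less[of "\<lambda>a. \<not> P a" "Suc A"] top by auto
    have "\<beta> (Suc a) ` set p = (\<lambda>y. y div 2) ` set (map (\<beta> a) p)"
      by (simp add: image_image \<beta>_Suc)
    then have "card ((\<lambda>y. y div 2) ` set (map (\<beta> a) p)) \<le> r - 2"
      using a(3) by (simp add: P_def)
    moreover have "set (map (\<beta> a) p) \<subseteq> {..<N a}"
    proof -
      have "\<beta> a x < N a" if "x \<in> set p" for x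
        using rank_less_card[OF V, of x] that pV(1)
        by (auto simp: \<beta>_def N_def n_def less_Suc_eq_le intro!: div_le_mono)
      then show ?thesis by auto
    qed
    ultimately have "map (\<beta> a) p \<in> Bs a" using pV(2) by (simp add: Bs_def)
    moreover have "p \<in> cls a (map (\<beta> a) p)" using p a(2) by (simp add: cls_def P_def)
    ultimately show "p \<in> (\<Union>a\<le>A. \<Union>b\<in>Bs a. cls a b)" using a(1) by auto
  qed
  have cls: "card (cls a b) \<le> C * (r * 2 ^ a) ^ (r - 1)" for a b
  proof (cases "cls a b = {}")
    case False
    then obtain p where p: "p \<in> E" "map (\<beta> a) p = b" "r - 1 \<le> card (set b)" by (auto simp: cls_def)
    have len: "length b = r" using p E by auto
    have "sorted p" using E[OF p(1)] strict_sorted_iff by blast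
    then have "sorted_wrt (\<lambda>x y. \<beta> a x \<le> \<beta> a y) p"
      by (rule sorted_wrt_mono_rel[rotated]) (rule \<beta>_mono)
    then have "sorted b" unfolding p(2)[symmetric] sorted_wrt_map .
    \<comment> \<open>The sorted pattern \<open>b\<close> has at least \<open>r - 1\<close> distinct
      blocks among \<open>r\<close>, so only one adjacent pair can coincide; it becomes the exempt
      pair.\<close>
    then obtain j where j: "\<And>i i'. i < i' \<Longrightarrow> i' < r \<Longrightarrow> \<not> (i = j \<and> i' = Suc j) \<Longrightarrow> b ! i < b ! i'"
      using sorted_almost_distinct[of b] p(3) unfolding len by blast
    have "separated j r (cls a b)"
      unfolding separated_def
    proof (intro ballI allI impI)
      fix q q' i i' assume q: "q \<in> cls a b" "q' \<in> cls a b" and i: "i < i'" "i' < r"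
        "\<not> (i = j \<and> i' = Suc j)"
      have "\<beta> a (s ! l) = b ! l" if "s \<in> cls a b" "l < r" for s l
        using that E[of s] by (auto simp: cls_def)
      with q i have "\<beta> a (q ! i) = b ! i" "\<beta> a (q' ! i') = b ! i'" by auto
      then have "\<beta> a (q ! i) < \<beta> a (q' ! i')" using j[OF i] by simp
      then show "q ! i < q' ! i'" using \<beta>_mono leD not_le_imp_less by blast
    qed
    moreover have "cls a b \<subseteq> E" by (auto simp: cls_def)
    \<comment> \<open>The class lives inside the blocks named by \<open>b\<close>, at most
      \<open>r\<close> of them with at most \<open>2 ^ a\<close> vertices each.\<close>
    moreover let ?V = "{v \<in> V. rank V v div 2 ^ a \<in> set b}"
    have "\<forall>p\<in>cls a b. set p \<subseteq> ?V" using E by (auto simp: cls_def \<beta>_def)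
    ultimately have "card (cls a b) \<le> C * card ?V ^ (r - 1)" using C[of "cls a b" ?V j] V by simp
    moreover have "card ?V \<le> card (set b) * 2 ^ a" using V by (intro card_rank_blocks_le) auto
    then have "card ?V \<le> r * 2 ^ a"
      using card_length[of b] len by (meson le_trans mult_le_mono1)
    then have "C * card ?V ^ (r - 1) \<le> C * (r * 2 ^ a) ^ (r - 1)"
      by (intro mult_le_mono2 power_mono) auto
    ultimately show ?thesis by linarith
  qed simp
  define K where "K = (2 * (r - 2)) ^ r * C * r ^ (r - 1)"
  have r': "r - 1 = Suc (r - 2)" using r by simp
  have level: "card (\<Union>b\<in>Bs a. cls a b) \<le> K * (2 * n) ^ (r - 2) * 2 ^ a" if "a \<le> A" for a
  proof -
    have "(2::nat) ^ a \<le> 2 ^ A" using that by (rule power_increasing) simp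
    then have "2 ^ a \<le> n" using A(1) by linarith
    moreover have "n div 2 ^ a * 2 ^ a \<le> n" by (rule div_times_less_eq_dividend)
    ultimately have N: "N a * 2 ^ a \<le> 2 * n"
      unfolding N_def add_mult_distrib by linarith
    have "card (\<Union>b\<in>Bs a. cls a b) \<le> (\<Sum>b\<in>Bs a. card (cls a b))"
      using finBs by (rule card_UN_le)
    also have "\<dots> \<le> (\<Sum>b\<in>Bs a. C * (r * 2 ^ a) ^ (r - 1))" by (intro sum_mono cls)
    also have "\<dots> = card (Bs a) * (C * (r * 2 ^ a) ^ (r - 1))" by simp
    also have "\<dots> \<le> N a ^ (r - 2) * (2 * (r - 2)) ^ r * (C * (r * 2 ^ a) ^ (r - 1))"
      using cardBs by (rule mult_le_mono1)
    \<comment> \<open>The exponents \<open>r - 2\<close> and \<open>r - 1\<close> differ by one: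
      pairing each \<open>N a\<close> with a \<open>2 ^ a\<close> leaves one factor
      \<open>2 ^ a\<close> over, which makes the sum over scales geometric.\<close>
    also have "\<dots> = K * (N a * 2 ^ a) ^ (r - 2) * 2 ^ a"
      by (simp only: K_def r' power_Suc power_mult_distrib mult_ac)
    also have "\<dots> \<le> K * (2 * n) ^ (r - 2) * 2 ^ a"
      using N by (intro mult_le_mono1 mult_le_mono2 power_mono) auto
    finally show ?thesis .
  qed
  have "finite E"
    using finite_lists_length_eq[OF V, of r] by (rule finite_subset[rotated]) (use E in auto)
  then have finU: "finite (\<Union>a\<le>A. \<Union>b\<in>Bs a. cls a b)"
    by (rule finite_subset[rotated]) (auto simp: cls_def)
  have "card E \<le> card (\<Union>a\<le>A. \<Union>b\<in>Bs a. cls a b)" using finU cover by (rule card_mono)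
  also have "\<dots> \<le> (\<Sum>a\<le>A. card (\<Union>b\<in>Bs a. cls a b))" by (rule card_UN_le) simp
  also have "\<dots> \<le> (\<Sum>a\<le>A. K * (2 * n) ^ (r - 2) * 2 ^ a)" using level by (intro sum_mono) auto
  also have "\<dots> = K * (2 * n) ^ (r - 2) * (\<Sum>a<Suc A. 2 ^ a)"
    by (simp only: sum_distrib_left lessThan_Suc_atMost)
  also have "(\<Sum>a<Suc A. 2 ^ a) \<le> 2 * n"
    using A(1) mask_eq_sum_exp_nat[of "Suc A"] by (simp add: lessThan_def)
  finally have "card E \<le> K * (2 * n) ^ (r - 2) * (2 * n)" by simp
  also have "\<dots> = K * 2 ^ (r - 1) * n ^ (r - 1)" by (simp only: r' power_Suc power_mult_distrib mult_ac)
  finally show ?thesis by (simp add: K_def n_def)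
qed simp

section \<open>The bound for all ordered \<open>r\<close>-graphs\<close>

theorem theorem1p6:
  fixes r :: nat and F :: "'a set set"
  assumes "r \<ge> 2" and "uniform_forest r F"
  shows "(\<lambda>n. real (ex_ordered r n (ord_family r F))) \<in> O(\<lambda>n. real n ^ (r - 1))"
proof -
  obtain C where C: "\<And>(H :: nat ohgraph) V E j. ordered_rgraph r H \<Longrightarrow>
    (\<forall>G\<in>ord_family r F. \<not> ocontains H G) \<Longrightarrow> E \<subseteq> sorted_list_of_set ` edges H \<Longrightarrow>
    finite V \<Longrightarrow> (\<forall>p\<in>E. set p \<subseteq> V) \<Longrightarrow> separated j r E \<Longrightarrow> card E \<le> C * card V ^ (r - 1)"
    using card_separated_le[OF assms] by metis
  define D where "D = max C ((2 * (r - 2)) ^ r * C * r ^ (r - 1) * 2 ^ (r - 1))"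
  have bound: "card (edges H) \<le> D * card (verts H) ^ (r - 1)"
    if H: "ordered_rgraph r H" and free: "\<forall>G\<in>ord_family r F. \<not> ocontains H G"
    for H :: "nat ohgraph"
  proof -
    define E where "E = sorted_list_of_set ` edges H"
    have V: "finite (verts H)" using H by (simp add: ordered_rgraph_def)
    have fin: "finite e" if "e \<in> edges H" for e
      using H that V unfolding ordered_rgraph_def by (meson finite_subset)
    have E: "length p = r \<and> sorted_wrt (<) p \<and> set p \<subseteq> verts H" if "p \<in> E" for p
      using that H fin unfolding E_def ordered_rgraph_def by auto
    have "inj_on sorted_list_of_set (edges H)"
      using fin by (intro inj_onI) (metis set_sorted_list_of_set)
    then have "card (edges H) = card E" by (simp add: E_def card_image)
    also have "card E \<le> D * card (verts H) ^ (r - 1)"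
    proof (cases "r = 2")
      case True
      \<comment> \<open>For \<open>r = 2\<close> the only pair of positions is \<open>0\<close> and
        \<open>1\<close>, which \<open>j = 0\<close> exempts.\<close>
      have "separated 0 r E" using True E unfolding separated_def by auto
      then have "card E \<le> C * card (verts H) ^ (r - 1)"
        using C[OF H free _ V] E by (simp add: E_def)
      then show ?thesis by (rule le_trans) (simp add: D_def)
    next
      case False
      then have "r \<ge> 3" using assms(1) by simp
      then have "card E \<le> (2 * (r - 2)) ^ r * C * r ^ (r - 1) * 2 ^ (r - 1) * card (verts H) ^ (r - 1)"
        using V E by (rule card_le_by_dyadic_blocks) (assumption, rule C[OF H free], simp only: E_def)
      then show ?thesis by (rule le_trans) (simp add: D_def)
    qed
    finally show ?thesis .
  qed
  have "ex_ordered r n (ord_family r F) \<le> D * n ^ (r - 1)" for n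
  proof -
    let ?X = "{card (edges H) | H :: nat ohgraph.
      ordered_rgraph r H \<and> card (verts H) = n \<and> (\<forall>G\<in>ord_family r F. \<not> ocontains H G)}"
    show ?thesis
    proof (cases "?X = {}")
      \<comment> \<open>This happens for instance if \<open>F\<close> is empty; the supremum of the
        empty set of naturals is 0.\<close>
      case True
      then have "ex_ordered r n (ord_family r F) = 0"
        unfolding ex_ordered_def by (simp only: Sup_nat_empty)
      then show ?thesis by simp
    next
      case False
      then show ?thesis
        unfolding ex_ordered_def by (rule cSup_least) (use bound in auto)
    qed
  qed
  then have "real (ex_ordered r n (ord_family r F)) \<le> real D * real n ^ (r - 1)" for n
    by (metis of_nat_le_iff of_nat_mult of_nat_power)
  then show ?thesis by (intro bigoI[of _ "real D"]) simp
qed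

end
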